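(* Let $\mathcal{A}=(a_{i_1\dots i_m})$ be a real symmetric tensor of even order $m$ and dimension $n$, and let $\lambda$ be an $H$-eigenvalue of $\mathcal{A}$. For $i\in[n]$ define $$\Psi_i=[a_{i\dots i}-\beta_i(\mathcal{A}),\ a_{i\dots i}-\gamma_i(\mathcal{A})],$$ and for $i\neq j\in[n]$ define $$\Psi^1_{ij}=\{x\in(-\infty,\min\{a_{i\dots i},a_{j\dots j}\}) : |a_{i\dots i}-\beta_i(\mathcal{A})-x|\,(|a_{j\dots j}-\beta_j(\mathcal{A})-x|-\Delta_j^i(\mathcal{A}))\leq(\beta_j(\mathcal{A})-a_{ji\dots i})\Delta_i(\mathcal{A})\},$$ $$\Psi^2_{ij}=\{x\in(a_{i\dots i},a_{j\dots j}) : |a_{i\dots i}-\gamma_i(\mathcal{A})-x|\,(|a_{j\dots j}-\beta_j(\mathcal{A})-x|-\Delta_j^i(\mathcal{A}))\leq(\beta_j(\mathcal{A})-a_{ji\dots i})\Theta_i(\mathcal{A})\},$$ $$\Psi^3_{ij}=\{x\in(a_{j\dots j},a_{i\dots i}) : |a_{i\dots i}-\beta_i(\mathcal{A})-x|\,(|a_{j\dots j}-\gamma_j(\mathcal{A})-x|-\Theta_j^i(\mathcal{A}))\leq(a_{ji\dots i}-\gamma_j(\mathcal{A}))\Delta_i(\mathcal{A})\},$$ $$\Psi^4_{ij}=\{x\in(\max\{a_{i\dots i},a_{j\dots j}\},+\infty) : |a_{i\dots i}-\gamma_i(\mathcal{A})-x|\,(|a_{j\dots j}-\gamma_j(\mathcal{A})-x|-\Theta_j^i(\mathcal{A}))\leq(a_{ji\dots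 i}-\gamma_j(\mathcal{A}))\Theta_i(\mathcal{A})\}.$$ Let $\Psi_{ij}=\Psi^1_{ij}\cup\Psi^2_{ij}\cup\Psi^4_{ij}$ if $a_{i\dots i}\leq a_{j\dots j}$, and $\Psi_{ij}=\Psi^1_{ij}\cup\Psi^3_{ij}\cup\Psi^4_{ij}$ if $a_{i\dots i}\geq a_{j\dots j}$. Then $$\lambda\in\Psi(\mathcal{A})=\Big(\bigcup_{i=1}^n\Psi_i\Big)\cup\Big(\bigcup_{i,j=1,\ i\neq j}^n\Psi_{ij}\Big).$$
   Context: $[n]=\{1,\dots,n\}$. A real tensor $\mathcal{A}$ of order $m$ and dimension $n$ is an array $(a_{i_1\dots i_m})$ of real numbers with all $i_j\in[n]$; it is symmetric if its entries are invariant under any permutation of their indices. For $x\in\mathbb{C}^n$, $\mathcal{A}x^{m-1}$ is the vector with $(\mathcal{A}x^{m-1})_i=\sum_{i_2,\dots,i_m=1}^n a_{ii_2\dots i_m}x_{i_2}\cdots x_{i_m}$, and $x^{[m-1]}$ is the vector with entries $x_i^{m-1}$. A real number $\lambda$ is an $H$-eigenvalue of $\mathcal{A}$ if there is a nonzero $x\in\mathbb{R}^n$ with $\mathcal{A}x^{m-1}=\lambda x^{[m-1]}$. For $i\neq j\in[n]$: $\beta_i(\mathcal{A})=\max\{0,\ a_{ii_2\dots i_m} : (i_2,\dots,i_m)\neq(i,\dots,i)\}$ (the maximum of $0$ and all these entries); $\gamma_i(\mathcal{A})=\min\{0,\ a_{ii_2\dots i_m} : (i_2,\dots,i_m)\neq(i,\dots,i)\}$;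 $\Delta_i(\mathcal{A})=\sum_{(i_2,\dots,i_m)\neq(i,\dots,i)}(\beta_i(\mathcal{A})-a_{ii_2\dots i_m})$; $\Theta_i(\mathcal{A})=\sum_{(i_2,\dots,i_m)\neq(i,\dots,i)}(a_{ii_2\dots i_m}-\gamma_i(\mathcal{A}))$; $\Delta_j^i(\mathcal{A})=\sum(\beta_j(\mathcal{A})-a_{jj_2\dots j_m})$ and $\Theta_j^i(\mathcal{A})=\sum(a_{jj_2\dots j_m}-\gamma_j(\mathcal{A}))$, both sums over all $(j_2,\dots,j_m)\in[n]^{m-1}$ with $(j_2,\dots,j_m)\neq(i,\dots,i)$ and $(j_2,\dots,j_m)\neq(j,\dots,j)$. The entry $a_{ji\dots i}$ has first index $j$ and the remaining $m-1$ indices equal to $i$. An open interval $(c,d)$ with $c\geq d$ is empty. *)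

theory Defs
  imports "HOL-Analysis.Analysis" "HOL-Combinatorics.Combinatorics"
begin

text \<open>
  The index set \<open>[n]\<close> is a finite type \<open>'n\<close>, with \<open>n = CARD('n)\<close>. A tensor of order \<open>m\<close> and
  dimension \<open>n\<close> is a function \<open>a :: 'n list \<Rightarrow> real\<close> of which only the values at multi-indices of
  length \<open>m\<close> are ever used; the order \<open>m\<close> is therefore passed explicitly. A row entry
  \<open>a\<^sub>i\<^sub>i\<^sub>2\<^sub>\<dots>\<^sub>i\<^sub>m\<close> is \<open>a (i # is)\<close> with \<open>is\<close> of length \<open>m - 1\<close>.
\<close>

definition symmetric_tensor :: "nat \<Rightarrow> ('n list \<Rightarrow> real) \<Rightarrow> bool" where
  "symmetric_tensor m a \<longleftrightarrow>
     (\<forall>is p. length is = m \<longrightarrow> p permutes {..<m} \<longrightarrow> a (permute_list p is) = a is)"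

definition tensor_apply :: "nat \<Rightarrow> ('n::finite list \<Rightarrow> real) \<Rightarrow> real ^ 'n \<Rightarrow> real ^ 'n" where
  "tensor_apply m a x =
     (\<chi> i. \<Sum>is | length is = m - 1. a (i # is) * (\<Prod>k\<leftarrow>is. x $ k))"

definition vec_power :: "real ^ 'n \<Rightarrow> nat \<Rightarrow> real ^ 'n" where
  "vec_power x k = (\<chi> i. (x $ i) ^ k)"

definition H_eigenvalue :: "nat \<Rightarrow> ('n::finite list \<Rightarrow> real) \<Rightarrow> real \<Rightarrow> bool" where
  "H_eigenvalue m a l \<longleftrightarrow>
     (\<exists>x :: real ^ 'n. x \<noteq> 0 \<and> tensor_apply m a x = l *\<^sub>R vec_power x (m - 1))"

definition diag_entry :: "nat \<Rightarrow> ('n list \<Rightarrow> real) \<Rightarrow> 'n \<Rightarrow> real" where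
  "diag_entry m a i = a (replicate m i)"

definition off_diag :: "nat \<Rightarrow> 'n \<Rightarrow> 'n list set" where
  "off_diag m i = {is. length is = m - 1 \<and> is \<noteq> replicate (m - 1) i}"

definition beta :: "nat \<Rightarrow> ('n::finite list \<Rightarrow> real) \<Rightarrow> 'n \<Rightarrow> real" where
  "beta m a i = Max (insert 0 ((\<lambda>is. a (i # is)) ` off_diag m i))"

definition gamma :: "nat \<Rightarrow> ('n::finite list \<Rightarrow> real) \<Rightarrow> 'n \<Rightarrow> real" where
  "gamma m a i = Min (insert 0 ((\<lambda>is. a (i # is)) ` off_diag m i))"

definition Delta :: "nat \<Rightarrow> ('n::finite list \<Rightarrow> real) \<Rightarrow> 'n \<Rightarrow> real" where
  "Delta m a i = (\<Sum>is\<in>off_diag m i. beta m a i - a (i # is))"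

definition Theta :: "nat \<Rightarrow> ('n::finite list \<Rightarrow> real) \<Rightarrow> 'n \<Rightarrow> real" where
  "Theta m a i = (\<Sum>is\<in>off_diag m i. a (i # is) - gamma m a i)"

text \<open>\<open>Delta2 m a j i\<close> and \<open>Theta2 m a j i\<close> are \<open>\<Delta>\<^sub>j\<^sup>i\<close> and \<open>\<Theta>\<^sub>j\<^sup>i\<close>: the row index \<open>j\<close> comes first.\<close>

definition Delta2 :: "nat \<Rightarrow> ('n::finite list \<Rightarrow> real) \<Rightarrow> 'n \<Rightarrow> 'n \<Rightarrow> real" where
  "Delta2 m a j i = (\<Sum>js\<in>off_diag m i \<inter> off_diag m j. beta m a j - a (j # js))"

definition Theta2 :: "nat \<Rightarrow> ('n::finite list \<Rightarrow> real) \<Rightarrow> 'n \<Rightarrow> 'n \<Rightarrow> real" where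
  "Theta2 m a j i = (\<Sum>js\<in>off_diag m i \<inter> off_diag m j. a (j # js) - gamma m a j)"

definition Psi_row :: "nat \<Rightarrow> ('n::finite list \<Rightarrow> real) \<Rightarrow> 'n \<Rightarrow> real set" where
  "Psi_row m a i = {diag_entry m a i - beta m a i .. diag_entry m a i - gamma m a i}"

definition Psi1 :: "nat \<Rightarrow> ('n::finite list \<Rightarrow> real) \<Rightarrow> 'n \<Rightarrow> 'n \<Rightarrow> real set" where
  "Psi1 m a i j = {x \<in> {..<min (diag_entry m a i) (diag_entry m a j)}.
     \<bar>diag_entry m a i - beta m a i - x\<bar> * (\<bar>diag_entry m a j - beta m a j - x\<bar> - Delta2 m a j i)
       \<le> (beta m a j - a (j # replicate (m - 1) i)) * Delta m a i}"

definition Psi2 :: "nat \<Rightarrow> ('n::finite list \<Rightarrow> real) \<Rightarrow> 'n \<Rightarrow> 'n \<Rightarrow> real set" where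
  "Psi2 m a i j = {x \<in> {diag_entry m a i <..< diag_entry m a j}.
     \<bar>diag_entry m a i - gamma m a i - x\<bar> * (\<bar>diag_entry m a j - beta m a j - x\<bar> - Delta2 m a j i)
       \<le> (beta m a j - a (j # replicate (m - 1) i)) * Theta m a i}"

definition Psi3 :: "nat \<Rightarrow> ('n::finite list \<Rightarrow> real) \<Rightarrow> 'n \<Rightarrow> 'n \<Rightarrow> real set" where
  "Psi3 m a i j = {x \<in> {diag_entry m a j <..< diag_entry m a i}.
     \<bar>diag_entry m a i - beta m a i - x\<bar> * (\<bar>diag_entry m a j - gamma m a j - x\<bar> - Theta2 m a j i)
       \<le> (a (j # replicate (m - 1) i) - gamma m a j) * Delta m a i}"

definition Psi4 :: "nat \<Rightarrow> ('n::finite list \<Rightarrow> real) \<Rightarrow> 'n \<Rightarrow> 'n \<Rightarrow> real set" where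
  "Psi4 m a i j = {x \<in> {max (diag_entry m a i) (diag_entry m a j)<..}.
     \<bar>diag_entry m a i - gamma m a i - x\<bar> * (\<bar>diag_entry m a j - gamma m a j - x\<bar> - Theta2 m a j i)
       \<le> (a (j # replicate (m - 1) i) - gamma m a j) * Theta m a i}"

text \<open>
  The two cases of the definition of \<open>\<Psi>\<^sub>i\<^sub>j\<close> overlap when the diagonal entries agree; then \<open>Psi2\<close> and
  \<open>Psi3\<close> are both empty, so the cases are consistent (lemma \<open>Psi_pair_ge\<close>).
\<close>

definition Psi_pair :: "nat \<Rightarrow> ('n::finite list \<Rightarrow> real) \<Rightarrow> 'n \<Rightarrow> 'n \<Rightarrow> real set" where
  "Psi_pair m a i j =
     (if diag_entry m a i \<le> diag_entry m a j
      then Psi1 m a i j \<union> Psi2 m a i j \<union> Psi4 m a i j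
      else Psi1 m a i j \<union> Psi3 m a i j \<union> Psi4 m a i j)"

lemma Psi_pair_ge:
  "diag_entry m a i \<ge> diag_entry m a j \<Longrightarrow>
     Psi_pair m a i j = Psi1 m a i j \<union> Psi3 m a i j \<union> Psi4 m a i j"
  by (auto simp: Psi_pair_def Psi2_def Psi3_def)

definition Psi :: "nat \<Rightarrow> ('n::finite list \<Rightarrow> real) \<Rightarrow> real set" where
  "Psi m a = (\<Union>i. Psi_row m a i) \<union> (\<Union>i. \<Union>j\<in>{j. j \<noteq> i}. Psi_pair m a i j)"

end

theory Submission
  imports Defs
begin

text \<open>
  Let \<open>l\<close> lie outside \<open>Psi m a\<close> and let \<open>x\<close> satisfy the eigenvalue equation. Leaving every
  \<open>Psi_row\<close> means that each row \<open>i\<close> has one of two types: \<open>l < a\<^sub>i\<^sub>i - \<beta>\<^sub>i\<close> (sign \<open>\<sigma>\<^sub>i = 1\<close>, put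
  \<open>b\<^sub>i = \<beta>\<^sub>i\<close>) or \<open>l > a\<^sub>i\<^sub>i - \<gamma>\<^sub>i\<close> (sign \<open>\<sigma>\<^sub>i = -1\<close>, put \<open>b\<^sub>i = - \<gamma>\<^sub>i\<close>). With \<open>t\<close> the off-diagonal
  part of the tensor, \<open>\<sigma>\<^sub>i t \<le> b\<^sub>i\<close> on row \<open>i\<close>, and the equation reads
  \<open>\<sigma>\<^sub>i r\<^sub>i x\<^sub>i\<^sup>m\<^sup>-\<^sup>1 + (row i of t applied to x) = 0\<close>, where the diagonal is split as
  \<open>a\<^sub>i\<^sub>i - l = \<sigma>\<^sub>i r\<^sub>i + \<sigma>\<^sub>i b\<^sub>i\<close> with \<open>r\<^sub>i > 0\<close> and the part \<open>\<sigma>\<^sub>i b\<^sub>i\<close> is counted as diagonal entry of \<open>t\<close>.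
  It has to be shown that \<open>x = 0\<close>.

  If all signs agree, one pairs the rows with \<open>x\<close> and uses that a symmetric tensor of this kind is
  positive definite. With both signs present and \<open>m > 2\<close> this breaks down: multiplying the rows by
  \<open>\<sigma>\<^sub>i\<close> destroys the symmetry, and an entry whose indices are split unevenly between the two types
  does not cancel from \<open>\<Sum>\<^sub>i \<sigma>\<^sub>i x\<^sub>i (row i)\<close>. The rows are therefore paired with
  another vector \<open>\<sigma>\<^sub>i y\<^sub>i\<close>, produced by a flow (locale \<open>clip_flow\<close>). Clip \<open>x\<close> at height \<open>s\<close>, let
  \<open>T(s)\<close> be the sum of the clipped coordinates, and let \<open>y\<close> start at \<open>0\<close> and grow by
  \<open>dy\<^sub>i = T(s)\<^sup>m\<^sup>-\<^sup>2 dx\<^sub>i\<close>. Two features make the pairing grow with \<open>s\<close>: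

  \<^item> only coordinates that have reached the height \<open>s\<close> move, and these are the largest ones, so in
    each of their rows the contribution of \<open>b\<^sub>i - \<sigma>\<^sub>i t\<close> is bounded entry by entry
    by what the diagonal term supplies (lemma \<open>heavy_row_bound\<close>);

  \<^item> what remains is summed over all multi-indices, hence is expressible by \<open>T\<close> and \<open>y\<close>, and
    because \<open>\<Sum>\<^sub>i y\<^sub>i = T\<^sup>m\<^sup>-\<^sup>1 / (m - 1)\<close> the contributions of opposite type cancel and leave the
    derivative of \<open>(m - 1) \<Sum> min b\<^sub>k b\<^sub>l y\<^sub>k y\<^sub>l\<close>, taken over pairs of equal type. The
    kernel \<open>min\<close> is positive semidefinite.

  So the pairing is nonnegative at the end, even with the smallest diagonal that the entry by entry
  bound permits, and a larger diagonal contradicts the equation unless \<open>x = 0\<close> (theorem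
  \<open>no_nonzero_solution\<close>).

  If all coordinates are clipped at the same height, the bound needs every \<open>r\<^sub>i\<close> to exceed the sum of
  \<open>b\<^sub>i - \<sigma>\<^sub>i t\<close> over row \<open>i\<close>. Leaving the sets \<open>Psi_pair\<close> gives only a condition on pairs of rows, under
  which one row may violate this. It yields weights \<open>\<kappa>\<close> making all rows dominant (lemma
  \<open>doubly_dominant_scaling\<close>), and coordinate \<open>i\<close> is clipped at \<open>\<kappa>\<^sub>i s\<close>.
\<close>

section \<open>Contraction of a tensor with a vector\<close>

text \<open>
  A tensor contracted with \<open>x\<close> in all \<open>N\<close> arguments. The recursion on the first index replaces
  sums over lists, which lets the product rule be proved without moving indices inside a list.
\<close>

primrec contract :: "('n::finite \<Rightarrow> real) \<Rightarrow> nat \<Rightarrow> ('n list \<Rightarrow> real) \<Rightarrow> real" where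
  "contract x 0 t = t []"
| "contract x (Suc N) t = (\<Sum>k\<in>UNIV. x k * contract x N (\<lambda>g. t (k # g)))"

lemma finite_lists_length: "finite {f :: 'n::finite list. length f = N}"
  using finite_lists_length_eq[of "UNIV :: 'n set" N] by simp

lemma contract_sum:
  "contract x N t = (\<Sum>f | length f = N. t f * (\<Prod>k\<leftarrow>f. x k))"
proof (induction N arbitrary: t)
  case 0
  then show ?case by simp
next
  case (Suc N)
  have eq: "{f :: 'a list. length f = Suc N} = (\<lambda>(k, g). k # g) ` (UNIV \<times> {g. length g = N})"
    by (auto simp: length_Suc_conv image_iff)
  have "(\<Sum>f | length f = Suc N. t f * (\<Prod>k\<leftarrow>f. x k))
      = (\<Sum>(k, g)\<in>UNIV \<times> {g. length g = N}. t (k # g) * (x k * (\<Prod>k\<leftarrow>g. x k)))"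
    unfolding eq by (subst sum.reindex) (auto simp: inj_on_def intro!: sum.cong)
  also have "\<dots> = (\<Sum>k\<in>UNIV. \<Sum>g | length g = N. t (k # g) * (x k * (\<Prod>k\<leftarrow>g. x k)))"
    by (simp add: sum.cartesian_product)
  finally show ?case
    by (simp add: Suc sum_distrib_left mult_ac)
qed

lemma contract_const: "contract x N (\<lambda>_. c) = c * (\<Sum>k\<in>UNIV. x k) ^ N"
  by (induction N) (simp_all flip: sum_distrib_right)

lemma contract_diff: "contract x N (\<lambda>f. t f - u f) = contract x N t - contract x N u"
  by (simp add: contract_sum left_diff_distrib sum_subtractf)

lemma contract_scale: "contract x N (\<lambda>f. c * t f) = c * contract x N t"
  by (simp add: contract_sum sum_distrib_left mult_ac)

lemma contract_abs_le:
  assumes "\<And>k. \<bar>x k\<bar> \<le> \<kappa> k * \<tau>" and "\<And>k. 0 \<le> \<kappa> k"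
    and "\<And>f. length f = N \<Longrightarrow> \<bar>t f\<bar> \<le> w f"
  shows "\<bar>contract x N t\<bar> \<le> \<tau> ^ N * contract \<kappa> N w"
  using assms(3)
proof (induction N arbitrary: t w)
  case 0
  then show ?case by simp
next
  case (Suc N)
  have "\<bar>contract x (Suc N) t\<bar> \<le> (\<Sum>k\<in>UNIV. \<bar>x k\<bar> * \<bar>contract x N (\<lambda>g. t (k # g))\<bar>)"
    by (simp add: abs_mult[symmetric] sum_abs)
  also have "\<dots> \<le> (\<Sum>k\<in>UNIV. (\<kappa> k * \<tau>) * (\<tau> ^ N * contract \<kappa> N (\<lambda>g. w (k # g))))"
  proof (rule sum_mono)
    fix k
    have "\<bar>contract x N (\<lambda>g. t (k # g))\<bar> \<le> \<tau> ^ N * contract \<kappa> N (\<lambda>g. w (k # g))"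
      by (rule Suc.IH) (simp add: Suc.prems)
    then show "\<bar>x k\<bar> * \<bar>contract x N (\<lambda>g. t (k # g))\<bar>
        \<le> (\<kappa> k * \<tau>) * (\<tau> ^ N * contract \<kappa> N (\<lambda>g. w (k # g)))"
      using assms(1)[of k] by (intro mult_mono) auto
  qed
  finally show ?case by (simp add: sum_distrib_left mult_ac)
qed

definition index_symmetric :: "('n list \<Rightarrow> real) \<Rightarrow> bool" where
  "index_symmetric t \<longleftrightarrow> (\<forall>e e'. mset e = mset e' \<longrightarrow> t e = t e')"

lemma index_symmetric_Cons: "index_symmetric t \<Longrightarrow> index_symmetric (\<lambda>g. t (k # g))"
  by (simp add: index_symmetric_def)

lemma index_symmetric_swap: "index_symmetric t \<Longrightarrow> t (k # l # g) = t (l # k # g)"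
  by (simp add: index_symmetric_def)

text \<open>
  The product rule produces \<open>Suc N\<close> terms, one for each position of the differentiated factor; by
  symmetry they all equal the term with that factor in front.
\<close>

lemma contract_has_derivative:
  assumes "index_symmetric t"
    and X: "\<And>k. ((\<lambda>s. X s k) has_real_derivative X' k) (at s)"
  shows "((\<lambda>s. contract (X s) (Suc N) t) has_real_derivative
           real (Suc N) * (\<Sum>l\<in>UNIV. X' l * contract (X s) N (\<lambda>g. t (l # g)))) (at s)"
  using assms(1)
proof (induction N arbitrary: t)
  case 0
  show ?case by (auto intro!: derivative_eq_intros X)
next
  case (Suc N)
  let ?C = "\<lambda>n t. contract (X s) n t"
  have IH: "((\<lambda>s. contract (X s) (Suc N) (\<lambda>g. t (k # g))) has_real_derivative
      real (Suc N) * (\<Sum>l\<in>UNIV. X' l * ?C N (\<lambda>g. t (k # l # g)))) (at s)" for k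
    by (rule Suc.IH[OF index_symmetric_Cons[OF Suc.prems]])
  have "((\<lambda>s. \<Sum>k\<in>UNIV. X s k * contract (X s) (Suc N) (\<lambda>g. t (k # g))) has_real_derivative
      (\<Sum>k\<in>UNIV. X' k * ?C (Suc N) (\<lambda>g. t (k # g))
        + (real (Suc N) * (\<Sum>l\<in>UNIV. X' l * ?C N (\<lambda>g. t (k # l # g)))) * X s k)) (at s)"
    by (intro DERIV_sum DERIV_mult X IH)
  moreover have "(\<Sum>k\<in>UNIV. (real (Suc N) * (\<Sum>l\<in>UNIV. X' l * ?C N (\<lambda>g. t (k # l # g)))) * X s k)
      = real (Suc N) * (\<Sum>l\<in>UNIV. X' l * ?C (Suc N) (\<lambda>g. t (l # g)))"
  proof -
    have "(\<Sum>k\<in>UNIV. (real (Suc N) * (\<Sum>l\<in>UNIV. X' l * ?C N (\<lambda>g. t (k # l # g)))) * X s k)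
        = real (Suc N) * (\<Sum>k\<in>UNIV. \<Sum>l\<in>UNIV. X' l * (X s k * ?C N (\<lambda>g. t (l # k # g))))"
      by (simp add: sum_distrib_left sum_distrib_right mult_ac index_symmetric_swap[OF Suc.prems])
    also have "\<dots> = real (Suc N) * (\<Sum>l\<in>UNIV. \<Sum>k\<in>UNIV. X' l * (X s k * ?C N (\<lambda>g. t (l # k # g))))"
      by (subst sum.swap) (rule refl)
    finally show ?thesis by (simp add: sum_distrib_left)
  qed
  ultimately show ?case
    by (simp add: sum.distrib algebra_simps)
qed

section \<open>Two analytic tools\<close>

text \<open>
  The matrix \<open>min (b k) (b l)\<close> is a nonnegative combination of all-ones blocks on the superlevel sets of \<open>b\<close>. The
  induction splits off the lowest block: subtracting the least value of \<open>b\<close> costs a multiple of a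
  square and makes one row and one column vanish.
\<close>

lemma min_kernel_nonneg:
  fixes b y :: "'a \<Rightarrow> real"
  assumes "finite A" and "\<And>k. k \<in> A \<Longrightarrow> 0 \<le> b k"
  shows "0 \<le> (\<Sum>k\<in>A. \<Sum>l\<in>A. min (b k) (b l) * y k * y l)"
  using assms
proof (induction "card A" arbitrary: A b)
  case 0
  then show ?case by simp
next
  case (Suc n)
  then have "A \<noteq> {}" by auto
  then have "Min (b ` A) \<in> b ` A"
    using Suc.prems(1) by (intro Min_in) auto
  then obtain p where p0: "p \<in> A" "b p = Min (b ` A)" by auto
  have p: "p \<in> A" "\<And>k. k \<in> A \<Longrightarrow> b p \<le> b k"
    using p0 Suc.prems(1) by (simp_all add: p0(2))
  let ?c = "\<lambda>k. b k - b p"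
  have "0 \<le> (\<Sum>k\<in>A - {p}. \<Sum>l\<in>A - {p}. min (?c k) (?c l) * y k * y l)"
    using Suc.hyps Suc.prems p by (intro Suc.hyps(1)) auto
  also have "\<dots> = (\<Sum>k\<in>A. \<Sum>l\<in>A. min (?c k) (?c l) * y k * y l)"
  proof -
    have z: "min 0 (b l - b p) = 0" "min (b l - b p) 0 = 0" if "l \<in> A" for l
      using p(2)[OF that] by auto
    show ?thesis
      using \<open>finite A\<close> p(1)
      by (intro sum.mono_neutral_cong_left) (auto simp: z intro!: sum.neutral sum.mono_neutral_left)
  qed
  also have "\<dots> = (\<Sum>k\<in>A. \<Sum>l\<in>A. (min (b k) (b l) - b p) * y k * y l)"
    by (intro sum.cong refl) (auto simp: min_def)
  also have "\<dots> = (\<Sum>k\<in>A. \<Sum>l\<in>A. min (b k) (b l) * y k * y l) - b p * (\<Sum>k\<in>A. y k)\<^sup>2"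
    by (simp add: power2_eq_square sum_product sum_distrib_left algebra_simps flip: sum_subtractf)
  finally show ?case
    using Suc.prems(2)[OF p(1)] by (smt (verit) mult_nonneg_nonneg zero_le_power2)
qed

lemma mono_off_finite:
  fixes f :: "real \<Rightarrow> real"
  assumes "0 \<le> M" "finite E" "continuous_on {0..M} f"
    and "\<And>s. s \<in> {0<..<M} - E \<Longrightarrow> (f has_real_derivative f' s) (at s)"
    and "\<And>s. s \<in> {0<..<M} - E \<Longrightarrow> 0 \<le> f' s"
  shows "f 0 \<le> f M"
proof -
  define g where "g s = (if s \<in> {0<..<M} - E then f' s else 0)" for s
  have "(g has_integral (f M - f 0)) {0..M}"
    by (rule fundamental_theorem_of_calculus_interior_strong[OF \<open>finite E\<close> \<open>0 \<le> M\<close>])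
      (use assms(3,4) in \<open>auto simp: g_def has_real_derivative_iff_has_vector_derivative\<close>)
  then have "0 \<le> f M - f 0"
    by (rule has_integral_nonneg) (use assms(5) in \<open>auto simp: g_def\<close>)
  then show ?thesis by simp
qed

lemma DERIV_comp_min:
  fixes F :: "real \<Rightarrow> real"
  assumes "(F has_real_derivative D) (at s)" and "s \<noteq> a"
  shows "((\<lambda>s. F (min a s)) has_real_derivative (if s < a then D else 0)) (at s)"
proof (cases "s < a")
  case True
  have "eventually (\<lambda>s. F (min a s) = F s) (nhds s)"
    using eventually_nhds_in_open[of "{..<a}" s] True by (auto elim!: eventually_mono)
  with assms True show ?thesis by (simp add: DERIV_cong_ev)
next
  case False
  then have "eventually (\<lambda>s. F (min a s) = F a) (nhds s)"
    using eventually_nhds_in_open[of "{a<..}" s] assms(2) by (auto elim!: eventually_mono)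
  with False show ?thesis by (simp add: DERIV_cong_ev)
qed

section \<open>The clipping flow\<close>

text \<open>
  The order of the tensor is \<open>N + 2\<close>. The hypothesis on \<open>t\<close> includes the diagonal entries, so the
  diagonal of the original tensor has to be split before the locale applies.
\<close>

locale clip_flow =
  fixes N :: nat and t :: "'n::finite list \<Rightarrow> real" and \<sigma> b \<kappa> x :: "'n \<Rightarrow> real"
  assumes even_N: "even N"
    and sym: "index_symmetric t"
    and sign: "\<sigma> i = 1 \<or> \<sigma> i = -1"
    and b_nonneg: "0 \<le> b i"
    and bound: "length f = Suc N \<Longrightarrow> \<sigma> i * t (i # f) \<le> b i"
    and \<kappa>_pos: "0 < \<kappa> i"
begin

definition w :: "'n \<Rightarrow> 'n list \<Rightarrow> real" where "w i f = b i - \<sigma> i * t (i # f)"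

text \<open>
  The threshold for the diagonal: row \<open>i\<close> with diagonal excess \<open>r i\<close> is dominant with respect to the
  weights \<open>\<kappa>\<close> if \<open>W i < r i * \<kappa> i ^ Suc N\<close>.
\<close>

definition W :: "'n \<Rightarrow> real" where "W i = contract \<kappa> (Suc N) (w i)"

text \<open>
  Coordinate \<open>i\<close> moves from height \<open>0\<close> up to height \<open>a i\<close> and then stays at \<open>x i\<close>; at height \<open>M\<close>
  the clipped vector is \<open>x\<close> itself.
\<close>

definition a :: "'n \<Rightarrow> real" where "a i = \<bar>x i\<bar> / \<kappa> i"

definition M :: real where "M = Max (range a)"

definition X :: "real \<Rightarrow> 'n \<Rightarrow> real" where "X s i = sgn (x i) * \<kappa> i * min (a i) s"

definition T :: "real \<Rightarrow> real" where "T s = (\<Sum>i\<in>UNIV. X s i)"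

text \<open>
  The speed of \<open>y\<close> relative to the clipped vector is \<open>T s ^ N\<close>, so \<open>y\<close> would vanish identically if
  this power did; with equal weights and \<open>N > 0\<close> that happens when positive and negative coordinates of each size
  are equally many. Then the lower bound in \<open>heavy_row_bound\<close>, which has \<open>T s ^ N\<close> as a factor, is
  zero for any speed, and speed \<open>1\<close> is used.
\<close>

definition degenerate :: bool where "degenerate \<longleftrightarrow> (\<forall>s\<in>{0..M}. T s ^ N = 0)"

definition \<rho> :: "real \<Rightarrow> real" where "\<rho> s = (if degenerate then 1 else T s ^ N)"

definition Y :: "real \<Rightarrow> real" where "Y s = integral {0..s} \<rho>"

definition y :: "real \<Rightarrow> 'n \<Rightarrow> real" where "y s i = sgn (x i) * \<kappa> i * Y (min (a i) s)"

text \<open>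
  The pairing of \<open>\<sigma> i * y s i\<close> with the rows at the clipped vector, when \<open>r i\<close> is replaced by its
  threshold \<open>W i / \<kappa> i ^ Suc N\<close>.
\<close>

definition S :: "real \<Rightarrow> real" where
  "S s = (\<Sum>i\<in>UNIV. \<kappa> i * W i * (Y (min (a i) s) * min (a i) s ^ Suc N))
       + (\<Sum>i\<in>UNIV. \<sigma> i * y s i * contract (X s) (Suc N) (\<lambda>f. t (i # f)))"

definition G :: "'n \<Rightarrow> 'n \<Rightarrow> real" where
  "G k l = (if \<sigma> k = \<sigma> l then min (b k) (b l) else 0)"

definition Q :: "real \<Rightarrow> real" where
  "Q s = (\<Sum>k\<in>UNIV. \<Sum>l\<in>UNIV. G k l * y s k * y s l)"

lemma a_nonneg: "0 \<le> a i"
  using \<kappa>_pos[of i] by (simp add: a_def)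

lemma a_le_M: "a i \<le> M"
  by (simp add: M_def)

lemma M_nonneg: "0 \<le> M"
  by (rule order_trans[OF a_nonneg a_le_M])

lemma continuous_X: "continuous_on A (\<lambda>s. X s i)"
  unfolding X_def by (intro continuous_intros)

lemma continuous_T: "continuous_on A T"
  unfolding T_def[abs_def] by (rule continuous_on_sum) (rule continuous_X)

lemma continuous_rho: "continuous_on A \<rho>"
proof (cases degenerate)
  case True
  then show ?thesis by (simp add: \<rho>_def[abs_def])
next
  case False
  then show ?thesis
    using continuous_on_power[OF continuous_T] by (simp add: \<rho>_def[abs_def])
qed

lemma rho_nonneg: "0 \<le> \<rho> s"
  using even_N by (simp add: \<rho>_def zero_le_even_power)

lemma Y_deriv:
  assumes "0 < s"
  shows "(Y has_real_derivative \<rho> s) (at s)"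
proof -
  have "(Y has_real_derivative \<rho> s) (at s within {0..s + 1})"
    unfolding Y_def[abs_def]
    by (rule integral_has_real_derivative[of 0 "s + 1" \<rho> s, OF continuous_rho]) (use assms in simp)
  moreover have "at s within {0..s + 1} = at s"
    by (rule at_within_interior) (use assms in simp)
  ultimately show ?thesis by (simp only:)
qed

lemma continuous_Y: "continuous_on {0..M} Y"
  unfolding Y_def[abs_def] by (intro indefinite_integral_continuous_1 integrable_continuous_interval continuous_rho)

lemma Y_0: "Y 0 = 0"
  by (simp add: Y_def)

lemma Y_mono: "0 \<le> s \<Longrightarrow> s \<le> s' \<Longrightarrow> Y s \<le> Y s'"
  unfolding Y_def
  by (intro integral_subset_le integrable_continuous_interval continuous_rho) (auto simp: rho_nonneg)

lemma Y_nonneg: "0 \<le> s \<Longrightarrow> 0 \<le> Y s"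
  using Y_mono[of 0 s] by (simp add: Y_0)

lemma continuous_Y_min: "continuous_on {0..M} (\<lambda>s. Y (min (a i) s))"
proof (rule continuous_on_compose2[OF continuous_Y])
  show "continuous_on {0..M} (\<lambda>s. min (a i) s)" by (intro continuous_intros)
qed (use a_nonneg[of i] in auto)

lemma continuous_y: "continuous_on {0..M} (\<lambda>s. y s i)"
  unfolding y_def by (intro continuous_intros continuous_Y_min)

lemma continuous_contract:
  "continuous_on {0..M} (\<lambda>s. contract (X s) n u)"
  by (induction n arbitrary: u) (auto intro!: continuous_intros continuous_X)

lemma continuous_S: "continuous_on {0..M} S"
  unfolding S_def[abs_def]
  by (intro continuous_intros continuous_Y_min continuous_y continuous_contract)

lemma continuous_Q: "continuous_on {0..M} Q"
  unfolding Q_def[abs_def] by (intro continuous_intros continuous_y)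

lemma abs_X_le: "0 \<le> s \<Longrightarrow> \<bar>X s k\<bar> \<le> \<kappa> k * s"
  using \<kappa>_pos[of k] a_nonneg[of k] by (auto simp: X_def abs_mult sgn_if intro!: mult_left_mono)

lemma abs_y_le:
  assumes "0 \<le> s" shows "\<bar>y s k\<bar> \<le> \<kappa> k * Y s"
proof -
  have "0 \<le> Y (min (a k) s)" "Y (min (a k) s) \<le> Y s"
    using assms a_nonneg[of k] by (auto intro!: Y_nonneg Y_mono)
  moreover have "0 \<le> Y s" using assms by (rule Y_nonneg)
  ultimately show ?thesis
    using \<kappa>_pos[of k] by (auto simp: y_def abs_mult sgn_if)
qed

text \<open>
  The coordinates that still move at height \<open>s\<close>: there \<open>X s i\<close> has its maximal size \<open>\<kappa> i * s\<close>.
\<close>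

definition heavy :: "real \<Rightarrow> 'n \<Rightarrow> real" where "heavy s i = (if s < a i then 1 else 0)"

lemma X_deriv:
  "s \<notin> range a \<Longrightarrow> ((\<lambda>s. X s i) has_real_derivative sgn (x i) * \<kappa> i * heavy s i) (at s)"
proof -
  assume "s \<notin> range a"
  with DERIV_comp_min[OF DERIV_ident, of s "a i"]
  have "((\<lambda>s. min (a i) s) has_real_derivative heavy s i) (at s)"
    unfolding heavy_def by blast
  from DERIV_cmult[OF this, of "sgn (x i) * \<kappa> i"] show ?thesis
    by (simp only: X_def)
qed

lemma y_deriv:
  "0 < s \<Longrightarrow> s \<notin> range a \<Longrightarrow>
    ((\<lambda>s. y s i) has_real_derivative sgn (x i) * \<kappa> i * (heavy s i * \<rho> s)) (at s)"
proof -
  assume s: "0 < s" "s \<notin> range a"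
  from DERIV_comp_min[OF Y_deriv[OF s(1)], of "a i"] s(2)
  have "((\<lambda>s. Y (min (a i) s)) has_real_derivative (if s < a i then \<rho> s else 0)) (at s)"
    by blast
  moreover have "(if s < a i then \<rho> s else 0) = heavy s i * \<rho> s"
    by (simp add: heavy_def)
  ultimately have "((\<lambda>s. Y (min (a i) s)) has_real_derivative heavy s i * \<rho> s) (at s)"
    by (simp only:)
  from DERIV_cmult[OF this, of "sgn (x i) * \<kappa> i"] show ?thesis
    by (simp only: y_def)
qed

text \<open>
  The rate at which the diagonal term of a moving row \<open>i\<close> grows in \<open>S\<close>, up to the factor \<open>\<kappa> i * W i\<close>.
\<close>

definition C :: "real \<Rightarrow> real" where "C s = \<rho> s * s ^ Suc N + real (Suc N) * s ^ N * Y s"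

lemma cost_deriv:
  assumes "0 < s" "s \<notin> range a"
  shows "((\<lambda>s. Y (min (a i) s) * min (a i) s ^ Suc N) has_real_derivative heavy s i * C s) (at s)"
proof -
  have "((\<lambda>s. Y s * s ^ Suc N) has_real_derivative C s) (at s)"
  proof -
    have pow: "((\<lambda>s. s ^ Suc N) has_real_derivative real (Suc N) * s ^ N) (at s)"
      using DERIV_pow[of "Suc N" s UNIV] by (simp only: diff_Suc_Suc diff_zero)
    show ?thesis
      unfolding C_def by (rule DERIV_mult[OF Y_deriv[OF assms(1)] pow])
  qed
  from DERIV_comp_min[OF this, of "a i"] assms(2)
  have "((\<lambda>s. Y (min (a i) s) * min (a i) s ^ Suc N) has_real_derivative
      (if s < a i then C s else 0)) (at s)"
    by blast
  moreover have "(if s < a i then C s else 0) = heavy s i * C s"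
    by (simp add: heavy_def)
  ultimately show ?thesis by (simp only:)
qed

lemma T_deriv:
  "s \<notin> range a \<Longrightarrow> (T has_real_derivative (\<Sum>i\<in>UNIV. sgn (x i) * \<kappa> i * heavy s i)) (at s)"
  unfolding T_def[abs_def] by (intro DERIV_sum X_deriv)

text \<open>
  This is why \<open>y\<close> is driven with speed \<open>T s ^ N\<close>: it makes \<open>T s ^ Suc N\<close> linear in \<open>y\<close>. Both sides
  vanish at height \<open>0\<close> and have the same derivative wherever no coordinate stops.
\<close>

lemma T_power:
  assumes "\<not> degenerate" "s \<in> {0..M}"
  shows "T s ^ Suc N = real (Suc N) * (\<Sum>i\<in>UNIV. y s i)"
proof -
  let ?f = "\<lambda>s. real (Suc N) * (\<Sum>i\<in>UNIV. y s i) - T s ^ Suc N"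
  have "continuous_on {0..s} (\<lambda>s. y s i)" for i
    by (rule continuous_on_subset[OF continuous_y]) (use assms(2) in auto)
  then have cont: "continuous_on {0..s} ?f"
    by (intro continuous_on_diff continuous_on_mult_left continuous_on_sum continuous_on_power
        continuous_T)
  have der: "(?f has_real_derivative 0) (at u)" if "u \<in> {0<..<s} - range a" for u
  proof -
    have "(?f has_real_derivative real (Suc N) * (\<Sum>i\<in>UNIV. sgn (x i) * \<kappa> i * (heavy u i * \<rho> u))
        - real (Suc N) * T u ^ N * (\<Sum>i\<in>UNIV. sgn (x i) * \<kappa> i * heavy u i)) (at u)"
      using that DERIV_power[OF T_deriv[of u], of "Suc N"]
      by (intro DERIV_diff DERIV_cmult DERIV_sum y_deriv) (auto simp: mult_ac)
    moreover have "real (Suc N) * (\<Sum>i\<in>UNIV. sgn (x i) * \<kappa> i * (heavy u i * \<rho> u))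
        - real (Suc N) * T u ^ N * (\<Sum>i\<in>UNIV. sgn (x i) * \<kappa> i * heavy u i) = 0"
      using assms(1) by (simp add: \<rho>_def sum_distrib_left mult_ac)
    ultimately show ?thesis by simp
  qed
  have s: "0 \<le> s" using assms(2) by simp
  have "?f 0 \<le> ?f s"
    by (rule mono_off_finite[OF s _ cont der]) simp_all
  moreover have "- ?f 0 \<le> - ?f s"
    by (rule mono_off_finite[OF s _ continuous_on_minus[OF cont] DERIV_minus[OF der]]) simp_all
  moreover have "?f 0 = 0"
    using a_nonneg by (simp add: y_def T_def X_def Y_0 min_absorb2)
  ultimately show ?thesis by linarith
qed

section \<open>The pairing increases along the flow\<close>

text \<open>
  A moving row \<open>l\<close> contributes its diagonal term, the motion of \<open>y s l\<close>, and, by symmetry of \<open>t\<close>, the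
  motion of \<open>X s l\<close> inside all other rows. The last two are both sums over \<open>k\<close> of the
  same contractions of \<open>t\<close> with its first two indices fixed to \<open>l\<close> and \<open>k\<close>.
\<close>

definition S' :: "real \<Rightarrow> real" where
  "S' s = (\<Sum>l\<in>UNIV. \<kappa> l * heavy s l * (W l * C s
     + sgn (x l) * (\<Sum>k\<in>UNIV. contract (X s) N (\<lambda>g. t (l # k # g))
         * (\<rho> s * \<sigma> l * X s k + real (Suc N) * \<sigma> k * y s k))))"

lemma S_deriv:
  assumes s: "0 < s" "s \<notin> range a"
  shows "(S has_real_derivative S' s) (at s)"
proof -
  let ?D = "\<lambda>i l. contract (X s) N (\<lambda>g. t (i # l # g))"
  let ?h = "\<lambda>i. sgn (x i) * \<kappa> i * heavy s i"
  have R: "((\<lambda>s. contract (X s) (Suc N) (\<lambda>f. t (i # f))) has_real_derivative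
      real (Suc N) * (\<Sum>l\<in>UNIV. ?h l * ?D i l)) (at s)" for i
    by (rule contract_has_derivative[OF index_symmetric_Cons[OF sym] X_deriv[OF s(2)]])
  have row: "((\<lambda>s. \<sigma> i * y s i * contract (X s) (Suc N) (\<lambda>f. t (i # f))) has_real_derivative
      \<sigma> i * (?h i * \<rho> s) * contract (X s) (Suc N) (\<lambda>f. t (i # f))
      + real (Suc N) * (\<Sum>l\<in>UNIV. ?h l * ?D i l) * (\<sigma> i * y s i)) (at s)" for i
  proof -
    have "((\<lambda>s. \<sigma> i * y s i) has_real_derivative \<sigma> i * (?h i * \<rho> s)) (at s)"
      using DERIV_cmult[OF y_deriv[OF s], of "\<sigma> i"] by (simp only: mult.assoc)
    from DERIV_mult[OF this R] show ?thesis .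
  qed
  have cost: "((\<lambda>s. \<kappa> i * W i * (Y (min (a i) s) * min (a i) s ^ Suc N)) has_real_derivative
      \<kappa> i * W i * (heavy s i * C s)) (at s)" for i
    by (rule DERIV_cmult[OF cost_deriv[OF s]])
  have "(S has_real_derivative
      (\<Sum>i\<in>UNIV. \<kappa> i * W i * (heavy s i * C s))
      + (\<Sum>i\<in>UNIV. \<sigma> i * (?h i * \<rho> s) * contract (X s) (Suc N) (\<lambda>f. t (i # f))
          + real (Suc N) * (\<Sum>l\<in>UNIV. ?h l * ?D i l) * (\<sigma> i * y s i))) (at s)"
    unfolding S_def[abs_def] by (rule DERIV_add[OF DERIV_sum[OF cost] DERIV_sum[OF row]])
  moreover have "(\<Sum>i\<in>UNIV. real (Suc N) * (\<Sum>l\<in>UNIV. ?h l * ?D i l) * (\<sigma> i * y s i))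
      = (\<Sum>l\<in>UNIV. ?h l * (\<Sum>k\<in>UNIV. ?D l k * (real (Suc N) * \<sigma> k * y s k)))"
  proof -
    have "(\<Sum>i\<in>UNIV. real (Suc N) * (\<Sum>l\<in>UNIV. ?h l * ?D i l) * (\<sigma> i * y s i))
        = (\<Sum>i\<in>UNIV. \<Sum>l\<in>UNIV. ?h l * (?D l i * (real (Suc N) * \<sigma> i * y s i)))"
      unfolding sum_distrib_left sum_distrib_right
      by (intro sum.cong refl) (simp only: index_symmetric_swap[OF sym] mult_ac)
    also have "\<dots> = (\<Sum>l\<in>UNIV. \<Sum>i\<in>UNIV. ?h l * (?D l i * (real (Suc N) * \<sigma> i * y s i)))"
      by (rule sum.swap)
    finally show ?thesis by (simp only: sum_distrib_left)
  qed
  moreover have "\<sigma> i * (?h i * \<rho> s) * contract (X s) (Suc N) (\<lambda>f. t (i # f))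
      = ?h i * (\<Sum>k\<in>UNIV. ?D i k * (\<rho> s * \<sigma> i * X s k))" for i
    by (simp only: contract.simps sum_distrib_left mult_ac)
  ultimately have "(S has_real_derivative
      (\<Sum>i\<in>UNIV. \<kappa> i * W i * (heavy s i * C s))
      + ((\<Sum>i\<in>UNIV. ?h i * (\<Sum>k\<in>UNIV. ?D i k * (\<rho> s * \<sigma> i * X s k)))
      + (\<Sum>l\<in>UNIV. ?h l * (\<Sum>k\<in>UNIV. ?D l k * (real (Suc N) * \<sigma> k * y s k))))) (at s)"
    by (simp only: sum.distrib)
  moreover have "S' s = (\<Sum>i\<in>UNIV. \<kappa> i * W i * (heavy s i * C s))
      + ((\<Sum>i\<in>UNIV. ?h i * (\<Sum>k\<in>UNIV. ?D i k * (\<rho> s * \<sigma> i * X s k)))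
      + (\<Sum>l\<in>UNIV. ?h l * (\<Sum>k\<in>UNIV. ?D l k * (real (Suc N) * \<sigma> k * y s k))))"
    unfolding S'_def sum.distrib[symmetric]
    by (intro sum.cong refl) (simp only: distrib_left sum.distrib mult_ac)
  ultimately show ?thesis by (simp only:)
qed

text \<open>
  The value around which \<open>\<sigma> k * t (l # k # g)\<close> is expanded, namely \<open>2 * min (b l) (b k) - b l\<close> for
  rows of equal type and \<open>- b l\<close> otherwise. It is chosen such that the deviation is at most
  \<open>w l (k # g)\<close> and that \<open>b l + c l k\<close> vanishes for rows of opposite type.
\<close>

definition c :: "'n \<Rightarrow> 'n \<Rightarrow> real" where "c l k = 2 * G l k - b l"

lemma w_nonneg: "length f = Suc N \<Longrightarrow> 0 \<le> w i f"
  using bound[of f i] by (simp add: w_def)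

text \<open>
  Symmetry of \<open>t\<close> enters here: the entry belongs to row \<open>l\<close> and to row \<open>k\<close>, so it obeys the bounds
  of both. If the types agree, this forces \<open>w l (k # g) \<ge> b l - min (b l) (b k)\<close>.
\<close>

lemma entry_deviation:
  assumes "length g = N"
  shows "\<bar>\<sigma> k * t (l # k # g) - c l k\<bar> \<le> w l (k # g)"
proof -
  have "\<sigma> l * t (l # k # g) \<le> b l" "\<sigma> k * t (l # k # g) \<le> b k"
    using bound[of "k # g" l] bound[of "l # g" k] assms index_symmetric_swap[OF sym, of l k g]
    by simp_all
  then show ?thesis
    using sign[of l] sign[of k] by (auto simp: c_def G_def w_def min_def)
qed

text \<open>
  Replace \<open>\<sigma> l * t\<close> by \<open>b l\<close> and \<open>\<sigma> k * t\<close> by \<open>c l k\<close>. Each replacement changes an entry by at most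
  \<open>w l\<close>, and since no coordinate exceeds \<open>\<kappa> k * s\<close> in size, nor \<open>y\<close> the value \<open>\<kappa> k * Y s\<close>, the total
  change is at most \<open>W l * C s\<close>. After the replacement the coefficients no longer depend on the
  remaining indices, and the contraction collapses to a power of \<open>T\<close>.
\<close>

lemma heavy_row_bound:
  assumes s: "0 \<le> s"
  shows "sgn (x l) * T s ^ N * (\<Sum>k\<in>UNIV. b l * \<rho> s * X s k + real (Suc N) * c l k * y s k)
    \<le> W l * C s + sgn (x l) * (\<Sum>k\<in>UNIV. contract (X s) N (\<lambda>g. t (l # k # g))
         * (\<rho> s * \<sigma> l * X s k + real (Suc N) * \<sigma> k * y s k))"
proof -
  let ?D = "\<lambda>k. contract (X s) N (\<lambda>g. t (l # k # g))"
  let ?w = "\<lambda>k. contract \<kappa> N (\<lambda>g. w l (k # g))"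
  let ?e = "sgn (x l)"
  have T: "contract (X s) N (\<lambda>_. r) = r * T s ^ N" for r
    by (simp only: contract_const T_def)
  have dev1: "\<bar>b l * T s ^ N - \<sigma> l * ?D k\<bar> \<le> s ^ N * ?w k" for k
  proof -
    have "b l * T s ^ N - \<sigma> l * ?D k = contract (X s) N (\<lambda>g. w l (k # g))"
      unfolding w_def contract_diff contract_scale T ..
    then show ?thesis
      using contract_abs_le[of "X s" \<kappa> s N "\<lambda>g. w l (k # g)" "\<lambda>g. w l (k # g)"]
        abs_X_le[OF s] \<kappa>_pos w_nonneg by (simp add: less_imp_le)
  qed
  have dev2: "\<bar>\<sigma> k * ?D k - c l k * T s ^ N\<bar> \<le> s ^ N * ?w k" for k
  proof -
    have "\<sigma> k * ?D k - c l k * T s ^ N = contract (X s) N (\<lambda>g. \<sigma> k * t (l # k # g) - c l k)"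
      unfolding contract_diff contract_scale T ..
    then show ?thesis
      using contract_abs_le[of "X s" \<kappa> s N "\<lambda>g. \<sigma> k * t (l # k # g) - c l k" "\<lambda>g. w l (k # g)"]
        abs_X_le[OF s] \<kappa>_pos entry_deviation by (simp add: less_imp_le)
  qed
  have e: "\<bar>?e\<bar> \<le> 1" by (simp add: abs_sgn_eq)
  have each: "?e * T s ^ N * (b l * \<rho> s * X s k + real (Suc N) * c l k * y s k)
      \<le> \<kappa> k * ?w k * C s + ?e * (?D k * (\<rho> s * \<sigma> l * X s k + real (Suc N) * \<sigma> k * y s k))" for k
  proof -
    have "?e * (\<rho> s * X s k) * (b l * T s ^ N - \<sigma> l * ?D k) \<le> (\<rho> s * (\<kappa> k * s)) * (s ^ N * ?w k)"
    proof -
      have "\<bar>?e * (\<rho> s * X s k)\<bar> \<le> 1 * (\<rho> s * (\<kappa> k * s))"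
        unfolding abs_mult[of ?e] using e rho_nonneg[of s] abs_X_le[OF s, of k]
        by (intro mult_mono) (auto simp: abs_mult intro: mult_left_mono)
      then have "\<bar>?e * (\<rho> s * X s k)\<bar> * \<bar>b l * T s ^ N - \<sigma> l * ?D k\<bar> \<le> (\<rho> s * (\<kappa> k * s)) * (s ^ N * ?w k)"
        using dev1[of k] by (intro mult_mono) auto
      then show ?thesis unfolding abs_mult[symmetric] by linarith
    qed
    moreover have "- (?e * (real (Suc N) * y s k) * (\<sigma> k * ?D k - c l k * T s ^ N))
        \<le> (real (Suc N) * (\<kappa> k * Y s)) * (s ^ N * ?w k)"
    proof -
      have "\<bar>?e * (real (Suc N) * y s k)\<bar> \<le> 1 * (real (Suc N) * (\<kappa> k * Y s))"
        unfolding abs_mult[of ?e] using e abs_y_le[OF s, of k]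
        by (intro mult_mono) (auto simp: abs_mult intro: mult_left_mono)
      then have "\<bar>?e * (real (Suc N) * y s k)\<bar> * \<bar>\<sigma> k * ?D k - c l k * T s ^ N\<bar>
          \<le> (real (Suc N) * (\<kappa> k * Y s)) * (s ^ N * ?w k)"
        using dev2[of k] by (intro mult_mono) auto
      then show ?thesis unfolding abs_mult[symmetric] by linarith
    qed
    moreover have "\<kappa> k * ?w k * C s
        = (\<rho> s * (\<kappa> k * s)) * (s ^ N * ?w k) + (real (Suc N) * (\<kappa> k * Y s)) * (s ^ N * ?w k)"
      by (simp add: C_def algebra_simps)
    ultimately show ?thesis by (simp add: algebra_simps)
  qed
  have "?e * T s ^ N * (\<Sum>k\<in>UNIV. b l * \<rho> s * X s k + real (Suc N) * c l k * y s k)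
      = (\<Sum>k\<in>UNIV. ?e * T s ^ N * (b l * \<rho> s * X s k + real (Suc N) * c l k * y s k))"
    by (rule sum_distrib_left)
  also have "\<dots> \<le> (\<Sum>k\<in>UNIV. \<kappa> k * ?w k * C s
      + ?e * (?D k * (\<rho> s * \<sigma> l * X s k + real (Suc N) * \<sigma> k * y s k)))"
    by (rule sum_mono) (rule each)
  also have "\<dots> = W l * C s + ?e * (\<Sum>k\<in>UNIV. ?D k * (\<rho> s * \<sigma> l * X s k + real (Suc N) * \<sigma> k * y s k))"
    by (simp only: sum.distrib W_def contract.simps sum_distrib_left sum_distrib_right)
  finally show ?thesis .
qed

text \<open>
  In the degenerate case the lower bound for the derivative of \<open>S\<close> is just zero, which is the
  multiple \<open>0\<close> of \<open>Q'\<close>.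
\<close>

definition q :: real where "q = (if degenerate then 0 else real (Suc N))"

definition Q' :: "real \<Rightarrow> real" where
  "Q' s = (\<Sum>l\<in>UNIV. 2 * (sgn (x l) * \<kappa> l * (heavy s l * \<rho> s)) * (\<Sum>k\<in>UNIV. G l k * y s k))"

lemma Q_deriv:
  assumes "0 < s" "s \<notin> range a"
  shows "(Q has_real_derivative Q' s) (at s)"
proof -
  let ?d = "\<lambda>i. sgn (x i) * \<kappa> i * (heavy s i * \<rho> s)"
  have "((\<lambda>s. G k l * y s k * y s l) has_real_derivative G k l * ?d k * y s l + ?d l * (G k l * y s k)) (at s)"
    for k l
    by (rule DERIV_mult[OF DERIV_cmult[OF y_deriv[OF assms]] y_deriv[OF assms]])
  then have "(Q has_real_derivative
      (\<Sum>k\<in>UNIV. \<Sum>l\<in>UNIV. G k l * ?d k * y s l + ?d l * (G k l * y s k))) (at s)"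
    unfolding Q_def[abs_def] by (intro DERIV_sum)
  moreover have "(\<Sum>k\<in>UNIV. \<Sum>l\<in>UNIV. G k l * ?d k * y s l + ?d l * (G k l * y s k)) = Q' s"
  proof -
    have G: "G k l = G l k" for k l by (simp add: G_def min.commute eq_commute)
    have "(\<Sum>k\<in>UNIV. \<Sum>l\<in>UNIV. ?d l * (G k l * y s k)) = (\<Sum>l\<in>UNIV. \<Sum>k\<in>UNIV. ?d l * (G l k * y s k))"
      by (subst sum.swap) (simp only: G)
    moreover have "(\<Sum>k\<in>UNIV. \<Sum>l\<in>UNIV. G k l * ?d k * y s l) = (\<Sum>l\<in>UNIV. \<Sum>k\<in>UNIV. ?d l * (G l k * y s k))"
      by (simp only: mult_ac)
    moreover have "Q' s = 2 * (\<Sum>l\<in>UNIV. \<Sum>k\<in>UNIV. ?d l * (G l k * y s k))"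
      by (simp only: Q'_def sum_distrib_left mult.assoc)
    ultimately show ?thesis by (simp only: sum.distrib)
  qed
  ultimately show ?thesis by (simp only:)
qed

text \<open>
  By \<open>T_power\<close> the term with \<open>b l\<close> becomes \<open>real (Suc N) * b l\<close> times the sum of all \<open>y s k\<close>, and
  \<open>b l + c l k = 2 * G l k\<close> removes the rows of opposite type.
\<close>

lemma row_sum_identity:
  assumes s: "s \<in> {0..M}"
  shows "T s ^ N * (\<Sum>k\<in>UNIV. b l * \<rho> s * X s k + real (Suc N) * c l k * y s k)
    = q * (2 * \<rho> s * (\<Sum>k\<in>UNIV. G l k * y s k))"
proof (cases degenerate)
  case True
  with s show ?thesis by (simp add: q_def degenerate_def)
next
  case False
  have "b l * T s ^ N * T s = b l * real (Suc N) * (\<Sum>k\<in>UNIV. y s k)"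
    using T_power[OF False s] by (simp add: mult_ac)
  moreover have "(\<Sum>k\<in>UNIV. b l * \<rho> s * X s k + real (Suc N) * c l k * y s k)
      = b l * T s ^ N * T s + real (Suc N) * (\<Sum>k\<in>UNIV. c l k * y s k)"
    using False
    by (simp add: sum.distrib T_def \<rho>_def sum_distrib_left[symmetric] sum_distrib_right[symmetric] mult.assoc)
  moreover have "(\<Sum>k\<in>UNIV. c l k * y s k) = 2 * (\<Sum>k\<in>UNIV. G l k * y s k) - b l * (\<Sum>k\<in>UNIV. y s k)"
    by (simp add: c_def left_diff_distrib sum_subtractf sum_distrib_left mult.assoc)
  ultimately show ?thesis
    using False by (simp add: q_def \<rho>_def algebra_simps)
qed

lemma S'_ge:
  assumes s: "s \<in> {0<..<M}"
  shows "q * Q' s \<le> S' s"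
proof -
  have "q * Q' s = (\<Sum>l\<in>UNIV. \<kappa> l * heavy s l *
      (sgn (x l) * T s ^ N * (\<Sum>k\<in>UNIV. b l * \<rho> s * X s k + real (Suc N) * c l k * y s k)))"
  proof -
    have "q * (2 * (sgn (x l) * \<kappa> l * (heavy s l * \<rho> s)) * (\<Sum>k\<in>UNIV. G l k * y s k))
      = \<kappa> l * heavy s l * (sgn (x l) * T s ^ N * (\<Sum>k\<in>UNIV. b l * \<rho> s * X s k + real (Suc N) * c l k * y s k))" for l
      using row_sum_identity[of s l] s by (simp add: mult_ac)
    then show ?thesis by (simp only: Q'_def sum_distrib_left)
  qed
  also have "\<dots> \<le> S' s"
    unfolding S'_def
    by (intro sum_mono mult_left_mono heavy_row_bound)
      (use s \<kappa>_pos in \<open>auto simp: heavy_def intro: less_imp_le\<close>)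
  finally show ?thesis .
qed

lemma Q_nonneg: "0 \<le> Q s"
proof -
  have half: "0 \<le> (\<Sum>k\<in>A. \<Sum>l\<in>A. min (b k) (b l) * y s k * y s l)" for A
    by (rule min_kernel_nonneg) (simp_all add: b_nonneg)
  define P where "P = {i. \<sigma> i = 1}"
  have split: "sum f UNIV = sum f P + sum f (- P)" for f :: "'n \<Rightarrow> real"
    using sum.union_disjoint[of P "- P" f] by (simp add: Compl_partition)
  have same: "\<sigma> k = \<sigma> l \<longleftrightarrow> (k \<in> P \<longleftrightarrow> l \<in> P)" for k l
    using sign[of k] sign[of l] by (auto simp: P_def)
  have "Q s = (\<Sum>k\<in>P. \<Sum>l\<in>P. min (b k) (b l) * y s k * y s l)
      + (\<Sum>k\<in>- P. \<Sum>l\<in>- P. min (b k) (b l) * y s k * y s l)"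
    unfolding Q_def split by (simp add: G_def same)
  then show ?thesis using half[of P] half[of "- P"] by simp
qed

lemma S_M_nonneg: "0 \<le> S M"
proof -
  have "S 0 - q * Q 0 \<le> S M - q * Q M"
  proof (rule mono_off_finite[of M "range a" "\<lambda>s. S s - q * Q s" "\<lambda>s. S' s - q * Q' s"])
    show "continuous_on {0..M} (\<lambda>s. S s - q * Q s)"
      by (intro continuous_on_diff continuous_on_mult_left continuous_S continuous_Q)
    show "((\<lambda>s. S s - q * Q s) has_real_derivative S' s - q * Q' s) (at s)"
      if "s \<in> {0<..<M} - range a" for s
      using that by (intro DERIV_diff DERIV_cmult S_deriv Q_deriv) auto
    show "0 \<le> S' s - q * Q' s" if "s \<in> {0<..<M} - range a" for s
      using S'_ge[of s] that by simp
  qed (simp_all add: M_nonneg)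
  moreover have "S 0 = 0" "Q 0 = 0"
    using a_nonneg by (simp_all add: S_def Q_def y_def Y_0 min_absorb2)
  moreover have "0 \<le> q * Q M"
    using Q_nonneg[of M] by (simp add: q_def)
  ultimately show ?thesis by simp
qed

text \<open>
  The choice of speed in the degenerate case is made for this lemma, without which the pairing could
  vanish for a nonzero \<open>x\<close>.
\<close>

lemma Y_M_pos:
  assumes "0 < M"
  shows "0 < Y M"
proof (rule ccontr)
  assume "\<not> 0 < Y M"
  then have "integral {0..M} \<rho> = 0"
    using Y_nonneg[of M] M_nonneg by (simp add: Y_def)
  then have "\<forall>s\<in>{0..M}. \<rho> s = 0"
    using integral_eq_0_iff[OF continuous_rho assms] rho_nonneg by simp
  moreover have "0 \<in> {0..M}" using assms by simp
  ultimately have "\<not> degenerate"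
    unfolding \<rho>_def by (metis zero_neq_one)
  then have "\<rho> s = T s ^ N" for s by (simp add: \<rho>_def)
  with \<open>\<forall>s\<in>{0..M}. \<rho> s = 0\<close> have degenerate
    unfolding degenerate_def by metis
  with \<open>\<not> degenerate\<close> show False ..
qed

text \<open>
  At height \<open>M\<close> the row equations turn the pairing into a sum of terms
  \<open>- (r i * \<kappa> i ^ Suc N - W i)\<close> times nonnegative factors, which is negative because the factor of the
  coordinate of greatest height is positive.
\<close>

theorem no_nonzero_solution:
  assumes rows: "\<And>i. \<sigma> i * r i * x i ^ Suc N + contract x (Suc N) (\<lambda>f. t (i # f)) = 0"
    and dom: "\<And>i. W i < r i * \<kappa> i ^ Suc N"
  shows "x i = 0"
proof (rule ccontr)
  assume "x i \<noteq> 0"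
  then have "0 < a i" using \<kappa>_pos[of i] by (simp add: a_def)
  then have M: "0 < M" using a_le_M[of i] by linarith
  have "M \<in> range a" unfolding M_def by (intro Max_in) auto
  then obtain p where p: "a p = M" by auto
  have x_eq: "x i = sgn (x i) * \<kappa> i * a i" for i
    using \<kappa>_pos[of i] by (simp add: a_def mult_sgn_abs)
  have XM: "X M = x"
    using x_eq a_le_M by (auto simp: X_def min_absorb1)
  have min: "min (a i) M = a i" for i by (rule min_absorb1) (rule a_le_M)
  have row: "\<sigma> i * y M i * contract (X M) (Suc N) (\<lambda>f. t (i # f))
      = - (\<kappa> i * (r i * \<kappa> i ^ Suc N) * (Y (a i) * a i ^ Suc N))" for i
  proof -
    have "contract (X M) (Suc N) (\<lambda>f. t (i # f)) = - (\<sigma> i * r i * x i ^ Suc N)"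
      using rows[of i] unfolding XM by linarith
    moreover have "\<sigma> i * \<sigma> i = 1" using sign[of i] by auto
    moreover have "sgn (x i) * x i ^ Suc N = (\<kappa> i * a i) ^ Suc N"
    proof (cases "x i = 0")
      case True
      then show ?thesis by (simp add: a_def)
    next
      case False
      have "sgn (x i) * x i ^ Suc N = \<bar>x i\<bar> * x i ^ N"
        by (simp add: abs_sgn mult_ac)
      also have "x i ^ N = \<bar>x i\<bar> ^ N"
        using even_N by (simp add: power_even_abs)
      also have "\<bar>x i\<bar> = \<kappa> i * a i" using \<kappa>_pos[of i] by (simp add: a_def)
      finally show ?thesis by simp
    qed
    ultimately have eq: "contract (X M) (Suc N) (\<lambda>f. t (i # f)) = - (\<sigma> i * r i * x i ^ Suc N)"
      "\<sigma> i * \<sigma> i = 1" "sgn (x i) * x i ^ Suc N = (\<kappa> i * a i) ^ Suc N"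
      by blast+
    have "\<sigma> i * y M i * contract (X M) (Suc N) (\<lambda>f. t (i # f))
        = - ((\<sigma> i * \<sigma> i) * \<kappa> i * Y (a i) * r i * (sgn (x i) * x i ^ Suc N))"
      unfolding eq(1) y_def min by (simp only: mult_ac mult_minus_right)
    also have "\<dots> = - (\<kappa> i * Y (a i) * r i * (\<kappa> i * a i) ^ Suc N)"
      unfolding eq(2,3) by simp
    also have "\<dots> = - (\<kappa> i * (r i * \<kappa> i ^ Suc N) * (Y (a i) * a i ^ Suc N))"
      by (simp only: power_mult_distrib mult_ac)
    finally show ?thesis .
  qed
  have "S M = (\<Sum>i\<in>UNIV. - (\<kappa> i * (r i * \<kappa> i ^ Suc N - W i) * (Y (a i) * a i ^ Suc N)))"
    unfolding S_def row min sum.distrib[symmetric]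
    by (intro sum.cong refl) (simp only: algebra_simps)
  also have "\<dots> = - (\<Sum>i\<in>UNIV. \<kappa> i * (r i * \<kappa> i ^ Suc N - W i) * (Y (a i) * a i ^ Suc N))"
    by (rule sum_negf)
  finally have "(\<Sum>i\<in>UNIV. \<kappa> i * (r i * \<kappa> i ^ Suc N - W i) * (Y (a i) * a i ^ Suc N)) \<le> 0"
    using S_M_nonneg by linarith
  moreover have "0 < (\<Sum>i\<in>UNIV. \<kappa> i * (r i * \<kappa> i ^ Suc N - W i) * (Y (a i) * a i ^ Suc N))"
  proof (rule sum_pos2[of _ p])
    have "0 < \<kappa> p * (r p * \<kappa> p ^ Suc N - W p)"
      using \<kappa>_pos[of p] dom[of p] by (intro mult_pos_pos) simp_all
    moreover have "0 < Y (a p) * a p ^ Suc N"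
      unfolding p using M Y_M_pos[OF M] by (intro mult_pos_pos zero_less_power)
    ultimately show "0 < \<kappa> p * (r p * \<kappa> p ^ Suc N - W p) * (Y (a p) * a p ^ Suc N)"
      by (rule mult_pos_pos)
    show "0 \<le> \<kappa> i * (r i * \<kappa> i ^ Suc N - W i) * (Y (a i) * a i ^ Suc N)" for i
      using \<kappa>_pos[of i] dom[of i] a_nonneg[of i] Y_nonneg[of "a i"]
      by (intro mult_nonneg_nonneg zero_le_power) simp_all
  qed simp_all
  ultimately show False by linarith
qed

end

lemma prod_list_le_power:
  fixes \<kappa> :: "'n \<Rightarrow> real"
  assumes "\<And>k. 0 \<le> \<kappa> k" "\<And>k. \<kappa> k \<le> c"
  shows "(\<Prod>k\<leftarrow>f. \<kappa> k) \<le> c ^ length f"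
proof (induction f)
  case (Cons k f)
  have "0 \<le> (\<Prod>k\<leftarrow>f. \<kappa> k)" by (induction f) (simp_all add: assms)
  then show ?case using Cons assms order_trans[OF assms] by (auto intro!: mult_mono)
qed simp

section \<open>Weights from dominance of pairs of rows\<close>

text \<open>
  If every row is dominant, all weights are \<open>1\<close>. Otherwise let row \<open>i\<close> fail; give it a weight whose
  \<open>n\<close>-th power is \<open>c > 1\<close> and leave the others at \<open>1\<close>, so that every product of \<open>n\<close> weights
  is at most \<open>c\<close>. The other rows stay dominant if \<open>c * \<Delta> j < r j\<close>. In row \<open>i\<close> it is enough to exploit
  one multi-index, constantly equal to some \<open>p \<noteq> i\<close>, whose product is \<open>1\<close>; the row becomes dominant when \<open>c\<close> exceeds a
  quotient \<open>K p\<close>. The condition on the pair \<open>i, j\<close> says \<open>K j * \<Delta> j < r j\<close>, so the index \<open>p\<close> that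
  minimises \<open>K\<close> leaves room for \<open>c\<close> slightly above \<open>K p\<close>.
\<close>

lemma doubly_dominant_scaling:
  fixes w :: "'n::finite \<Rightarrow> 'n list \<Rightarrow> real" and r :: "'n \<Rightarrow> real" and n :: nat
  defines "\<Delta> i \<equiv> \<Sum>f | length f = n. w i f"
  assumes n: "0 < n"
    and w_nonneg: "\<And>i f. length f = n \<Longrightarrow> 0 \<le> w i f"
    and w_diag: "\<And>i. w i (replicate n i) = 0"
    and r_pos: "\<And>i. 0 < r i"
    and dom: "\<And>i j. i \<noteq> j \<Longrightarrow>
      w i (replicate n j) * \<Delta> j < r j * (r i - (\<Delta> i - w i (replicate n j)))"
  obtains \<kappa> where "\<And>i. 0 < \<kappa> i" "\<And>i. contract \<kappa> n (w i) < r i * \<kappa> i ^ n"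
proof (cases "\<forall>i. \<Delta> i < r i")
  case True
  show ?thesis
    by (rule that[of "\<lambda>_. 1"]) (use True in \<open>simp_all add: contract_sum \<Delta>_def map_replicate_const prod_list_replicate\<close>)
next
  case False
  then obtain i where i: "r i \<le> \<Delta> i" by (auto simp: not_less)
  have \<Delta>_nonneg: "0 \<le> \<Delta> j" for j
    unfolding \<Delta>_def by (rule sum_nonneg) (simp add: w_nonneg)
  let ?J = "- {i}"
  let ?\<delta> = "\<lambda>j. w i (replicate n j)"
  let ?p = "\<lambda>j. r i - (\<Delta> i - ?\<delta> j)"
  have \<delta>: "0 \<le> ?\<delta> j" for j by (rule w_nonneg) simp
  have p: "0 < ?p j" if "j \<noteq> i" for j
  proof -
    have "0 \<le> ?\<delta> j * \<Delta> j" using \<delta> \<Delta>_nonneg by simp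
    then have "0 < r j * ?p j" using dom[of i j] that by fastforce
    then show ?thesis using r_pos[of j] by (simp add: zero_less_mult_iff)
  qed
  define K where "K j = ?\<delta> j / ?p j" for j
  have "?J \<noteq> {}"
  proof
    assume "?J = {}"
    then have UNIV: "k = i" for k by auto
    have "f = replicate n i" if "length f = n" for f
      using that UNIV by (metis replicate_eqI)
    then have "w i f = 0" if "length f = n" for f
      using that w_diag[of i] by metis
    then have "\<Delta> i = 0" unfolding \<Delta>_def by simp
    then show False using i r_pos[of i] by simp
  qed
  then have "Min (K ` ?J) \<in> K ` ?J" by (intro Min_in) auto
  then obtain p0 where "p0 \<in> ?J" "Min (K ` ?J) = K p0" by (rule imageE) simp
  then have p0: "p0 \<noteq> i" "K p0 = Min (K ` ?J)" by simp_all
  have K_le: "K p0 \<le> K j" if "j \<noteq> i" for j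
    unfolding p0(2) using that by (intro Min_le) auto
  \<comment> \<open>Row \<open>i\<close> fails to be dominant, so its numerator is at least its denominator.\<close>
  have K_ge_1: "1 \<le> K p0"
    using p[OF p0(1)] i by (simp add: K_def)
  have K\<Delta>: "K p0 * \<Delta> j < r j" if "j \<noteq> i" for j
  proof -
    have "K p0 * \<Delta> j \<le> K j * \<Delta> j"
      by (rule mult_right_mono[OF K_le[OF that] \<Delta>_nonneg])
    also have "\<dots> < r j"
      using dom[of i j] that p[OF that] by (simp add: K_def field_simps)
    finally show ?thesis .
  qed
  have "eventually (\<lambda>c. \<forall>j\<in>?J. c * \<Delta> j < r j) (at_right (K p0))"
  proof (intro eventually_ball_finite ballI)
    fix j assume "j \<in> ?J"
    have "((\<lambda>c. c * \<Delta> j) \<longlongrightarrow> K p0 * \<Delta> j) (at_right (K p0))"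
      by (intro tendsto_intros)
    then show "eventually (\<lambda>c. c * \<Delta> j < r j) (at_right (K p0))"
      using K\<Delta>[of j] \<open>j \<in> ?J\<close> by (intro order_tendstoD(2)) auto
  qed simp
  moreover have "eventually (\<lambda>c. K p0 < c) (at_right (K p0))"
    by (rule eventually_at_right_less)
  ultimately have "eventually (\<lambda>c. (\<forall>j\<in>?J. c * \<Delta> j < r j) \<and> K p0 < c) (at_right (K p0))"
    by (rule eventually_conj)
  then obtain c where c: "\<And>j. j \<noteq> i \<Longrightarrow> c * \<Delta> j < r j" "K p0 < c"
    using eventually_happens'[of "at_right (K p0)"] by (metis (no_types, lifting) Compl_iff singletonD trivial_limit_at_right_real)
  have c1: "1 < c" using K_ge_1 c(2) by simp
  define \<kappa> where "\<kappa> k = (if k = i then root n c else 1)" for k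
  have root: "root n c ^ n = c" "1 < root n c"
    using n c1 by (simp_all add: real_root_pow_pos2)
  have prod_le: "(\<Prod>k\<leftarrow>f. \<kappa> k) \<le> c" if "length f = n" for f
    using prod_list_le_power[of \<kappa> "root n c" f] root that by (simp add: \<kappa>_def)
  have prod_one: "(\<Prod>k\<leftarrow>replicate n p0. \<kappa> k) = 1"
    using p0(1) by (simp add: \<kappa>_def prod_list_replicate)
  show ?thesis
  proof (rule that[of \<kappa>])
    show "0 < \<kappa> j" for j using root by (simp add: \<kappa>_def)
    show "contract \<kappa> n (w j) < r j * \<kappa> j ^ n" for j
    proof (cases "j = i")
      case False
      have "contract \<kappa> n (w j) \<le> (\<Sum>f | length f = n. w j f * c)"
        unfolding contract_sum
        by (intro sum_mono mult_left_mono) (simp_all add: prod_le w_nonneg)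
      also have "\<dots> = c * \<Delta> j" by (simp add: \<Delta>_def sum_distrib_right[symmetric])
      also have "\<dots> < r j" by (rule c(1)[OF False])
      finally have "contract \<kappa> n (w j) < r j" .
      moreover have "\<kappa> j = 1" using False by (simp add: \<kappa>_def)
      ultimately show ?thesis by simp
    next
      case True
      let ?L = "{f :: 'n list. length f = n}" and ?f = "replicate n p0"
      have fin: "finite ?L" by (rule finite_lists_length)
      have mem: "?f \<in> ?L" by simp
      have "contract \<kappa> n (w i) = ?\<delta> p0 + (\<Sum>f\<in>?L - {?f}. w i f * (\<Prod>k\<leftarrow>f. \<kappa> k))"
        unfolding contract_sum sum.remove[OF fin mem] prod_one by simp
      also have "\<dots> \<le> ?\<delta> p0 + (\<Sum>f\<in>?L - {?f}. w i f * c)"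
        by (intro add_left_mono sum_mono mult_left_mono) (simp_all add: prod_le w_nonneg)
      also have "(\<Sum>f\<in>?L - {?f}. w i f * c) = (\<Delta> i - ?\<delta> p0) * c"
        unfolding \<Delta>_def sum.remove[OF fin mem] by (simp add: sum_distrib_right)
      also have "?\<delta> p0 + (\<Delta> i - ?\<delta> p0) * c < r i * c"
        using c(2) p[OF p0(1)] by (simp add: K_def field_simps)
      finally have "contract \<kappa> n (w i) < r i * c" .
      moreover have "\<kappa> j ^ n = c" using True root by (simp add: \<kappa>_def)
      ultimately show ?thesis using True by simp
    qed
  qed
qed

section \<open>The inclusion theorem\<close>

text \<open>
  Changing the diagonal of a symmetric tensor keeps it symmetric, since a multiset of indices
  determines whether an entry is diagonal. Entries of any other length are set to zero, so that
  symmetry holds for all lists.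
\<close>

lemma index_symmetric_tensorI:
  assumes "symmetric_tensor m a"
  shows "index_symmetric (\<lambda>e. if length e = m then if \<exists>i. e = replicate m i then d (hd e) else a e else 0)"
  unfolding index_symmetric_def
proof (intro allI impI)
  fix e e' :: "'a list"
  assume mset: "mset e = mset e'"
  have len: "length e = length e'" using mset by (rule mset_eq_length)
  have rep: "e = replicate m i \<longleftrightarrow> e' = replicate m i" for i
    using mset by (metis mset_replicate mset_eq_length length_replicate replicate_eqI set_mset_mset set_replicate_conv_if in_set_replicate)
  show "(if length e = m then if \<exists>i. e = replicate m i then d (hd e) else a e else 0) =
     (if length e' = m then if \<exists>i. e' = replicate m i then d (hd e') else a e' else 0)"
  proof (cases "length e = m \<and> \<not> (\<exists>i. e = replicate m i)")
    case True
    obtain p where "p permutes {..<length e'}" "permute_list p e' = e"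
      using mset_eq_permutation[OF mset] by blast
    then have "a e = a e'"
      using assms True len unfolding symmetric_tensor_def by metis
    then show ?thesis using True len rep by simp
  next
    case False
    show ?thesis
    proof (cases "length e = m")
      case True
      with False obtain i where i: "e = replicate m i" by blast
      moreover from this have "e' = replicate m i" using rep by blast
      ultimately show ?thesis by simp
    qed (use len in simp)
  qed
qed

lemma off_diag_finite: "finite (off_diag m (i::'n::finite))"
  by (rule finite_subset[OF _ finite_lists_length[of "m - 1"]]) (auto simp: off_diag_def)

lemma entry_le_beta: "is \<in> off_diag m i \<Longrightarrow> a (i # is) \<le> beta m a (i::'n::finite)"
  unfolding beta_def by (rule Max_ge) (simp_all add: off_diag_finite)

lemma beta_nonneg: "0 \<le> beta m a (i::'n::finite)"
  unfolding beta_def by (rule Max_ge) (simp_all add: off_diag_finite)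

lemma gamma_le_entry: "is \<in> off_diag m i \<Longrightarrow> gamma m a (i::'n::finite) \<le> a (i # is)"
  unfolding gamma_def by (rule Min_le) (simp_all add: off_diag_finite)

lemma gamma_nonpos: "gamma m a (i::'n::finite) \<le> 0"
  unfolding gamma_def by (rule Min_le) (simp_all add: off_diag_finite)

theorem theorem4p2:
  fixes m :: nat and a :: "'n::finite list \<Rightarrow> real" and l :: real
  assumes "m > 0" and "even m"
    and "symmetric_tensor m a"
    and "H_eigenvalue m a l"
  shows "l \<in> Psi m a"
proof (rule ccontr)
  assume not_in: "l \<notin> Psi m a"
  obtain N where m: "m = Suc (Suc N)" and N: "even N"
    using assms(1,2) by (metis even_Suc not0_implies_Suc not_gr0 odd_one One_nat_def)
  define n where "n = Suc N"
  have m1: "m - 1 = n" by (simp add: m n_def)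
  let ?d = "diag_entry m a"
  define \<sigma> :: "'n \<Rightarrow> real" where "\<sigma> i = (if l < ?d i then 1 else -1)" for i
  define b where "b i = (if l < ?d i then beta m a i else - gamma m a i)" for i
  define r where "r i = \<sigma> i * (?d i - l) - b i" for i
  define t where "t e = (if length e = m then if \<exists>i. e = replicate m i then \<sigma> (hd e) * b (hd e) else a e else 0)" for e
  define w where excess: "w i f = b i - \<sigma> i * t (i # f)" for i f
  define \<Delta> where "\<Delta> i = (\<Sum>f | length f = n. w i f)" for i
  have t_diag: "t (i # replicate n i) = \<sigma> i * b i" for i
  proof -
    have "i # replicate n i = replicate m i" by (simp add: m n_def)
    then show ?thesis by (auto simp: t_def m)
  qed
  have t_off: "t (i # f) = a (i # f)" if "f \<in> off_diag m i" for i f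
  proof -
    have f: "length f = n" "f \<noteq> replicate n i" using that unfolding off_diag_def m1 by auto
    have "\<not> (\<exists>k. i # f = replicate m k)" using f by (auto simp: m n_def)
    then show ?thesis using f by (simp add: t_def m n_def)
  qed
  have \<sigma>2: "\<sigma> i * \<sigma> i = 1" for i by (simp add: \<sigma>_def)
  have w_diag: "w i (replicate n i) = 0" for i
    using \<sigma>2[of i] by (simp add: excess t_diag mult.assoc[symmetric])
  have w_off: "w i f = (if l < ?d i then beta m a i - a (i # f) else a (i # f) - gamma m a i)"
    if "f \<in> off_diag m i" for i f
    using t_off[OF that] by (simp add: excess b_def \<sigma>_def)
  have off: "off_diag m i = {f. length f = n} - {replicate n i}" for i :: 'n
    unfolding off_diag_def m1 by auto
  have w_nonneg: "0 \<le> w i f" if "length f = n" for i f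
  proof (cases "f = replicate n i")
    case False
    then have "f \<in> off_diag m i" using that by (simp add: off)
    then show ?thesis
      using w_off[of f i] entry_le_beta[of f m i a] gamma_le_entry[of f m i a] by auto
  qed (simp add: w_diag)
  have b_nonneg: "0 \<le> b i" for i
    using beta_nonneg[of m a i] gamma_nonpos[of m a i] by (simp add: b_def)
  have row: "l \<notin> Psi_row m a i" and pair: "j \<noteq> i \<Longrightarrow> l \<notin> Psi_pair m a i j" for i j
    using not_in by (auto simp: Psi_def)
  have r_pos: "0 < r i" for i
    using row[of i] beta_nonneg[of m a i] gamma_nonpos[of m a i]
    by (auto simp: Psi_row_def r_def b_def \<sigma>_def)
  have \<Delta>_off: "\<Delta> i = (\<Sum>f\<in>off_diag m i. w i f)" for i
    unfolding \<Delta>_def off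
    by (subst sum.remove[OF finite_lists_length, of "replicate n i"]) (simp_all add: w_diag)
  have \<Delta>_eq: "\<Delta> i = (if l < ?d i then Delta m a i else Theta m a i)" for i
    by (simp add: \<Delta>_off Delta_def Theta_def w_off)
  have \<Delta>2_eq: "\<Delta> j - w j (replicate n i) = (if l < ?d j then Delta2 m a j i else Theta2 m a j i)"
    and w_rep: "w j (replicate n i) = (if l < ?d j then beta m a j - a (j # replicate (m - 1) i)
        else a (j # replicate (m - 1) i) - gamma m a j)" if "i \<noteq> j" for i j
  proof -
    have mem: "replicate n i \<in> off_diag m j"
      using that by (simp add: off n_def)
    show "w j (replicate n i) = (if l < ?d j then beta m a j - a (j # replicate (m - 1) i)
        else a (j # replicate (m - 1) i) - gamma m a j)"
      unfolding m1 by (rule w_off[OF mem])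
    have "off_diag m i \<inter> off_diag m j = off_diag m j - {replicate n i}"
      by (auto simp: off)
    moreover have "\<Delta> j = w j (replicate n i) + (\<Sum>f\<in>off_diag m j - {replicate n i}. w j f)"
      unfolding \<Delta>_off by (rule sum.remove[OF off_diag_finite mem])
    ultimately show "\<Delta> j - w j (replicate n i) = (if l < ?d j then Delta2 m a j i else Theta2 m a j i)"
      by (simp add: Delta2_def Theta2_def w_off)
  qed
  have r_eq: "r i = (if l < ?d i then \<bar>?d i - beta m a i - l\<bar> else \<bar>?d i - gamma m a i - l\<bar>)" for i
    using r_pos[of i] by (auto simp: r_def \<sigma>_def b_def)
  have l_ne: "l \<noteq> ?d i" for i
    using r_pos[of i] b_nonneg[of i] by (auto simp: r_def)
  \<comment> \<open>The types of rows \<open>i\<close> and \<open>j\<close> place \<open>l\<close> relative to both diagonal entries, and so in the interval of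
    exactly one of the four sets.\<close>
  have dom: "w j (replicate n i) * \<Delta> i < r i * (r j - (\<Delta> j - w j (replicate n i)))" if "j \<noteq> i" for i j
  proof -
    have out: "l \<notin> Psi1 m a i j" "l \<notin> Psi4 m a i j"
      "?d i \<le> ?d j \<Longrightarrow> l \<notin> Psi2 m a i j" "\<not> ?d i \<le> ?d j \<Longrightarrow> l \<notin> Psi3 m a i j"
      using pair[OF that] by (simp_all add: Psi_pair_def split: if_splits)
    have "\<not> r i * (r j - (\<Delta> j - w j (replicate n i))) \<le> w j (replicate n i) * \<Delta> i"
    proof (cases "l < ?d i"; cases "l < ?d j")
      assume "l < ?d i" "l < ?d j"
      with out(1) show ?thesis
        unfolding \<Delta>2_eq[OF that[symmetric]] unfolding w_rep[OF that[symmetric]] \<Delta>_eq r_eq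
        by (simp add: Psi1_def)
    next
      assume *: "l < ?d i" "\<not> l < ?d j"
      then have "?d j < l" "\<not> ?d i \<le> ?d j" using l_ne[of j] by auto
      with * out(4) show ?thesis
        unfolding \<Delta>2_eq[OF that[symmetric]] unfolding w_rep[OF that[symmetric]] \<Delta>_eq r_eq
        by (simp add: Psi3_def)
    next
      assume *: "\<not> l < ?d i" "l < ?d j"
      then have "?d i < l" "?d i \<le> ?d j" using l_ne[of i] by auto
      with * out(3) show ?thesis
        unfolding \<Delta>2_eq[OF that[symmetric]] unfolding w_rep[OF that[symmetric]] \<Delta>_eq r_eq
        by (simp add: Psi2_def)
    next
      assume *: "\<not> l < ?d i" "\<not> l < ?d j"
      then have "?d i < l" "?d j < l" using l_ne[of i] l_ne[of j] by auto
      with * out(2) show ?thesis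
        unfolding \<Delta>2_eq[OF that[symmetric]] unfolding w_rep[OF that[symmetric]] \<Delta>_eq r_eq
        by (simp add: Psi4_def)
    qed
    then show ?thesis by simp
  qed
  obtain \<kappa> where \<kappa>: "\<And>i. 0 < \<kappa> i" "\<And>i. contract \<kappa> n (w i) < r i * \<kappa> i ^ n"
    by (rule doubly_dominant_scaling[of n w r])
      (use w_nonneg w_diag r_pos dom in \<open>auto simp: n_def \<Delta>_def\<close>)
  obtain x :: "real ^ 'n" where x: "x \<noteq> 0" "tensor_apply m a x = l *\<^sub>R vec_power x (m - 1)"
    using assms(4) unfolding H_eigenvalue_def by blast
  interpret clip_flow N t \<sigma> b \<kappa> "\<lambda>i. x $ i"
  proof
    show "index_symmetric t"
      using index_symmetric_tensorI[OF assms(3), of "\<lambda>i. \<sigma> i * b i"] by (simp only: t_def[abs_def])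
    show "\<sigma> i * t (i # f) \<le> b i" if "length f = Suc N" for f i
      using w_nonneg[of f i] that by (simp add: excess n_def)
  qed (use N b_nonneg \<kappa>(1) in \<open>simp_all add: \<sigma>_def\<close>)
  have "x $ i = 0" for i
  proof (rule no_nonzero_solution)
    show "W i < r i * \<kappa> i ^ Suc N" for i
      using \<kappa>(2)[of i] by (simp only: W_def w_def[abs_def] excess[abs_def] n_def)
    show "\<sigma> i * r i * (x $ i) ^ Suc N + contract (\<lambda>i. x $ i) (Suc N) (\<lambda>f. t (i # f)) = 0" for i
    proof -
      let ?L = "{f :: 'n list. length f = n}" and ?P = "\<lambda>f. \<Prod>k\<leftarrow>f. x $ k"
      have fin: "finite ?L" and mem: "replicate n i \<in> ?L"
        by (simp_all add: finite_lists_length)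
      have diag: "?P (replicate n i) = (x $ i) ^ n"
        by (simp add: prod_list_replicate)
      have "tensor_apply m a x $ i = l * (x $ i) ^ n"
        unfolding x(2) vec_power_def m1 by simp
      then have "l * (x $ i) ^ n = (\<Sum>f\<in>?L. a (i # f) * ?P f)"
        unfolding tensor_apply_def m1 by simp
      also have "\<dots> = ?d i * (x $ i) ^ n + (\<Sum>f\<in>off_diag m i. a (i # f) * ?P f)"
        unfolding off by (subst sum.remove[OF fin mem]) (simp add: diag diag_entry_def m n_def)
      finally have "l * (x $ i) ^ n = ?d i * (x $ i) ^ n + (\<Sum>f\<in>off_diag m i. a (i # f) * ?P f)" .
      moreover have "contract (\<lambda>i. x $ i) n (\<lambda>f. t (i # f))
          = \<sigma> i * b i * (x $ i) ^ n + (\<Sum>f\<in>off_diag m i. a (i # f) * ?P f)"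
      proof -
        have "(\<Sum>f\<in>off_diag m i. t (i # f) * ?P f) = (\<Sum>f\<in>off_diag m i. a (i # f) * ?P f)"
          by (intro sum.cong refl) (simp add: t_off)
        moreover have "contract (\<lambda>i. x $ i) n (\<lambda>f. t (i # f))
            = t (i # replicate n i) * ?P (replicate n i) + (\<Sum>f\<in>off_diag m i. t (i # f) * ?P f)"
          unfolding contract_sum off by (rule sum.remove[OF fin mem])
        ultimately show ?thesis by (simp only: t_diag diag)
      qed
      moreover have "\<sigma> i * r i * (x $ i) ^ n
          = ?d i * (x $ i) ^ n - l * (x $ i) ^ n - \<sigma> i * b i * (x $ i) ^ n"
        by (simp add: r_def right_diff_distrib left_diff_distrib mult.assoc[symmetric] \<sigma>2)
      ultimately show ?thesis
        unfolding n_def[symmetric] by linarith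
    qed
  qed
  then have "x = 0" by (simp add: vec_eq_iff)
  with x(1) show False ..
qed

end
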